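(* Suppose $n$ is a positive integer that is not a product of two primes and $n=p_1^{\alpha_1}p_2^{\alpha_2}\cdots p_r^{\alpha_r}$, where $r \geq 2$, $p_1 < p_2 < \cdots < p_r$ are primes and $\alpha_i \in \mathbb{N}$ for $1 \leq i \leq r$. Then $$\kappa(\mathcal{G}(\mathbb{Z}_n)) \leq \phi(n) + \frac{n}{p_r^{\alpha_r}} + \phi\left(\frac{n}{p_r^{\alpha_r}}\right) \left(p_r^{\alpha_r-1}-2\right).$$
   Context: $\mathbb{N}$ denotes the positive integers and $\phi$ is Euler's phi function. $\mathbb{Z}_n$ is the additive group of integers modulo $n$. The power graph $\mathcal{G}(\mathbb{Z}_n)$ is the simple undirected graph with vertex set $\mathbb{Z}_n$ in which two distinct vertices are adjacent if one is a positive integer multiple of the other. The vertex connectivity $\kappa(\Gamma)$ of a graph $\Gamma$ is the minimum number of vertices whose removal results in a disconnected graph or a trivial graph (one vertex, no edges). The right-hand side is an integer expression in which $p_r^{\alpha_r-1}-2$ may be negative. *)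

theory Defs
  imports
    "HOL-Number_Theory.Totient"
    "HOL-Algebra.Elementary_Groups"
    "Graph_Theory.Graph_Theory"
begin

text \<open>
  As usual in \<^theory>\<open>Graph_Theory.Digraph\<close>, a simple undirected graph is a loop-free symmetric
  digraph without parallel arcs (locale \<^locale>\<open>pair_graph\<close>).  The group is written
  multiplicatively, so in \<open>\<int>\<^sub>n\<close> the power \<open>x [^] k\<close> is the multiple \<open>k x\<close>.
\<close>

definition power_graph :: "('a, 'm) monoid_scheme \<Rightarrow> 'a pair_pre_digraph" where
  "power_graph G =
     \<lparr> pverts = carrier G,
       parcs = {(x, y). x \<in> carrier G \<and> y \<in> carrier G \<and> x \<noteq> y \<and>
                  (\<exists>k::nat. 0 < k \<and> (y = x [^]\<^bsub>G\<^esub> k \<or> x = y [^]\<^bsub>G\<^esub> k))} \<rparr>"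

definition trivial_graph :: "('a, 'b) pre_digraph \<Rightarrow> bool" where
  "trivial_graph G \<longleftrightarrow> card (verts G) = 1 \<and> arcs G = {}"

text \<open>
  Only proper vertex subsets are removed: the null graph counts neither as disconnected nor as
  trivial here, although \<open>connected\<close> is false for it in \<^theory>\<open>Graph_Theory.Digraph_Component\<close>.
\<close>

definition vertex_connectivity :: "('a, 'b) pre_digraph \<Rightarrow> nat" where
  "vertex_connectivity G =
     (LEAST k. \<exists>S. finite S \<and> S \<subset> verts G \<and> card S = k \<and>
        (let H = induce_subgraph G (verts G - S)
         in \<not> connected H \<or> trivial_graph H))"

lemma pair_graph_power_graph:
  assumes "finite (carrier G)"
  shows "pair_graph (power_graph G)"
proof
  have "parcs (power_graph G) \<subseteq> carrier G \<times> carrier G"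
    by (auto simp: power_graph_def)
  then show "finite (parcs (power_graph G))"
    using assms by (meson finite_SigmaI finite_subset)
qed (auto simp: power_graph_def assms symmetric_def sym_def)

text \<open>The minimum in the definition above exists for every finite simple graph with a vertex.\<close>

lemma vertex_connectivity_attained:
  assumes "digraph G" and "verts G \<noteq> {}"
  obtains S where "finite S" "S \<subset> verts G" "card S = vertex_connectivity G"
    "\<not> connected (induce_subgraph G (verts G - S)) \<or>
     trivial_graph (induce_subgraph G (verts G - S))"
proof -
  interpret digraph G by fact
  obtain v where v: "v \<in> verts G" using assms(2) by blast
  define S where "S = verts G - {v}"
  have "verts G - S = {v}" using v by (auto simp: S_def)
  then have "trivial_graph (induce_subgraph G (verts G - S))"
    by (auto simp: trivial_graph_def dest: no_loops)
  moreover have "finite S" "S \<subset> verts G" using v by (auto simp: S_def)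
  ultimately have "\<exists>k S. finite S \<and> S \<subset> verts G \<and> card S = k \<and>
        (let H = induce_subgraph G (verts G - S) in \<not> connected H \<or> trivial_graph H)"
    by (auto simp: Let_def)
  from LeastI_ex[OF this] show thesis
    using that by (auto simp: vertex_connectivity_def Let_def)
qed

end

theory Submission
  imports Defs
begin

text \<open>
  Write \<open>n = m * Q\<close> with \<open>Q = p r ^ \<alpha> r\<close>, so that \<open>m\<close> and \<open>Q\<close> are coprime and both exceed 1.
  The cut is the neighbourhood of the class \<open>C\<close> of elements of order \<open>m\<close> in \<open>\<int>\<^sub>n\<close>.  In a cyclic
  group two elements can only be adjacent if the order of one divides the order of the other, so
  every neighbour of \<open>C\<close> outside \<open>C\<close> lies in \<open>A\<close>, the subgroup of elements whose order divides
  \<open>m\<close>, or in \<open>B\<close>, the set of elements whose order is a multiple of \<open>m\<close>; moreover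
  \<open>A \<inter> B = C\<close>.  Hence removing \<open>(A \<union> B) - C\<close> separates \<open>C\<close> from all remaining elements, and there
  are some, for instance those whose order is a divisor of \<open>Q\<close> other than 1.

  In terms of residues, \<open>A\<close> consists of the multiples of \<open>Q\<close> and \<open>B\<close> of the residues coprime to
  \<open>m\<close>, which gives \<open>card A = m\<close>, \<open>card B = Q * totient m\<close> and \<open>card C = totient m\<close>.  The cut has
  \<open>m + Q * totient m - 2 * totient m\<close> elements, and this is the asserted bound because
  \<open>totient n = totient m * (p r ^ \<alpha> r - p r ^ (\<alpha> r - 1))\<close>.
\<close>

lemma disconnected_if_no_arcs_between:
  assumes "u \<in> C" "u \<in> verts G" "v \<in> verts G" "v \<notin> C"
    and no_arcs: "\<And>x y. (x, y) \<in> arcs_ends G \<Longrightarrow> x \<in> C \<longleftrightarrow> y \<in> C"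
  shows "\<not> connected G"
proof
  assume "connected G"
  then have "(u, v) \<in> rtrancl_on (verts G) ((arcs_ends G)\<^sup>s)"
    using assms(2,3) by (auto simp: connected_conv)
  then have "v \<in> C"
  proof (induction rule: rtrancl_on_induct)
    case (step y z)
    then show ?case using no_arcs by (auto simp: symcl_def)
  qed (simp add: \<open>u \<in> C\<close>)
  with \<open>v \<notin> C\<close> show False by simp
qed

lemma vertex_connectivity_le_card_separator:
  assumes "finite S" "S \<subset> verts G" and "\<not> connected (induce_subgraph G (verts G - S))"
  shows "vertex_connectivity G \<le> card S"
  unfolding vertex_connectivity_def Let_def by (rule Least_le) (use assms in blast)

lemma card_coprime_residues:
  assumes "1 < m"
  shows "card {x \<in> {0..<int m}. coprime x (int m)} = totient m"
proof -
  have "{x \<in> {0..<int m}. coprime x (int m)} = int ` totatives m"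
  proof (intro equalityI subsetI)
    fix x assume x: "x \<in> {x \<in> {0..<int m}. coprime x (int m)}"
    then obtain k where k: "x = int k" using nonneg_int_cases by auto
    \<comment> \<open>Residues start at 0, totatives at 1; they agree since 0 is not coprime to \<open>m > 1\<close>.\<close>
    have "k \<noteq> 0" using x k assms by (intro notI) auto
    then show "x \<in> int ` totatives m" using x k by (auto simp: in_totatives_iff)
  qed (use assms totatives_less in \<open>auto simp: in_totatives_iff\<close>)
  then show ?thesis by (simp add: totient_def card_image)
qed

text \<open>
  Coprimality to \<open>m\<close> has period \<open>m\<close>, and the interval below consists of \<open>Q\<close> periods.
\<close>

lemma card_coprime_residues_periods:
  assumes "1 < m"
  shows "card {x \<in> {0..<int (m * Q)}. coprime x (int m)} = Q * totient m"
proof -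
  let ?T = "{x \<in> {0..<int m}. coprime x (int m)}"
  let ?B = "{x \<in> {0..<int (m * Q)}. coprime x (int m)}"
  have m: "0 < int m" using assms by simp
  have "bij_betw (\<lambda>x. (x div int m, x mod int m)) ?B ({0..<int Q} \<times> ?T)"
  proof (rule bij_betw_byWitness[where f' = "\<lambda>(j, t). int m * j + t"])
    show "(\<lambda>x. (x div int m, x mod int m)) ` ?B \<subseteq> {0..<int Q} \<times> ?T"
    proof clarify
      fix x assume x: "x \<in> {0..<int (m * Q)}" "coprime x (int m)"
      have "int m * (x div int m) \<le> x" 
        using mult_div_mod_eq[of "int m" x] pos_mod_sign[OF m, of x] by linarith
      also have "\<dots> < int m * int Q" using x by simp
      finally have "x div int m < int Q" using m by (simp only: mult_less_cancel_left_pos)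
      then show "x div int m \<in> {0..<int Q} \<and> x mod int m \<in> ?T"
        using x m by (auto simp: pos_imp_zdiv_nonneg_iff)
    qed
    show "(\<lambda>(j, t). int m * j + t) ` ({0..<int Q} \<times> ?T) \<subseteq> ?B"
    proof clarify
      fix j t assume j: "j \<in> {0..<int Q}" and t: "t \<in> {0..<int m}" "coprime t (int m)"
      have "int m * j + t < int m * (j + 1)" using t by (simp add: algebra_simps)
      also have "\<dots> \<le> int m * int Q" using j by (intro mult_left_mono) auto
      finally have "int m * j + t < int (m * Q)" by simp
      moreover have "coprime ((int m * j + t) mod int m) (int m)" using t by simp
      then have "coprime (int m * j + t) (int m)" using m by (simp only: coprime_mod_left_iff)
      ultimately show "int m * j + t \<in> {0..<int (m * Q)} \<and> coprime (int m * j + t) (int m)"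
        using j t by auto
    qed
  qed (use m in auto)
  then have "card ?B = card ({0..<int Q} \<times> ?T)" by (rule bij_betw_same_card)
  then show ?thesis by (simp only: card_cartesian_product card_coprime_residues[OF assms]) simp
qed

lemma power_graph_integer_mod_group_arc_cases:
  assumes "0 < n" and "(x, y) \<in> parcs (power_graph (integer_mod_group n))"
  obtains k where "y = (k * x) mod int n" | k where "x = (k * y) mod int n"
proof -
  obtain k :: nat where
    "y = x [^]\<^bsub>integer_mod_group n\<^esub> k \<or> x = y [^]\<^bsub>integer_mod_group n\<^esub> k"
    using assms(2) by (auto simp: power_graph_def)
  then show thesis using that by auto
qed

text \<open>
  Being a multiple of \<open>Q\<close> passes from \<open>x\<close> to the multiples of \<open>x\<close>, and being coprime to \<open>m\<close> passes
  from a multiple of \<open>x\<close> to \<open>x\<close>; reduction modulo \<open>n\<close> respects both because \<open>m\<close> and \<open>Q\<close> divide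
  \<open>n\<close>.  So a neighbour of an element with both properties has at least one of them.
\<close>

lemma neighbour_of_order_class:
  fixes x y k :: int
  assumes "0 < n" "Q dvd n" "m dvd n"
    and "(x, y) \<in> parcs (power_graph (integer_mod_group n)) \<or>
         (y, x) \<in> parcs (power_graph (integer_mod_group n))"
    and x: "int Q dvd x" "coprime x (int m)"
  shows "int Q dvd y \<or> coprime y (int m)"
proof -
  consider k where "y = (k * x) mod int n" | k where "x = (k * y) mod int n"
    using assms(4) by (auto elim!: power_graph_integer_mod_group_arc_cases[OF \<open>0 < n\<close>])
  then show ?thesis
  proof cases
    case 1
    then have "int Q dvd y" using x(1) \<open>Q dvd n\<close> by (simp add: dvd_mod_iff)
    then show ?thesis ..
  next
    case 2
    have "coprime y (int m)"
    proof (rule coprimeI)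
      fix d assume d: "d dvd y" "d dvd int m"
      then have "d dvd int n" using \<open>m dvd n\<close> by (meson dvd_trans int_dvd_int_iff)
      then have "d dvd x" using d(1) 2 by (simp add: dvd_mod_iff)
      then show "is_unit d" using d(2) x(2) by (meson coprime_common_divisor)
    qed
    then show ?thesis ..
  qed
qed

text \<open>
  The multiples of \<open>Q\<close> that are coprime to \<open>m\<close> are the residues of order \<open>m\<close>, and the bound is the
  size of their neighbourhood.  The term \<open>2 * totient m\<close> stands on the left to avoid a truncated
  subtraction: the class itself is counted once among the \<open>m\<close> multiples of \<open>Q\<close> and once among the
  \<open>Q * totient m\<close> residues coprime to \<open>m\<close>, but is not removed.
\<close>

lemma vertex_connectivity_power_graph_coprime_factors:
  assumes m: "1 < m" and Q: "1 < Q" and cop: "coprime m Q"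
  shows "vertex_connectivity (with_proj (power_graph (integer_mod_group (m * Q)))) + 2 * totient m
    \<le> m + Q * totient m"
proof -
  let ?n = "m * Q"
  let ?G = "with_proj (power_graph (integer_mod_group ?n))"
  define A where "A = {x \<in> {0..<int ?n}. int Q dvd x}"
  define B where "B = {x \<in> {0..<int ?n}. coprime x (int m)}"
  define C where "C = A \<inter> B"
  define S where "S = A \<union> B - C"
  have n: "0 < ?n" using m Q by simp
  have verts: "pverts (power_graph (integer_mod_group ?n)) = {0..<int ?n}"
    using n by (simp add: power_graph_def carrier_integer_mod_group)
  have Q_mult: "{x \<in> {0..<int ?n}. int Q dvd x \<and> P x} = (*) (int Q) ` {t \<in> {0..<int m}. P (int Q * t)}"
    for P using Q by (auto simp: zero_le_mult_iff mult.commute[of "int m"])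
  have inj: "inj_on ((*) (int Q)) X" for X using Q by (auto simp: inj_on_def)
  have card_A: "card A = m"
  proof -
    have "A = (*) (int Q) ` {0..<int m}"
      unfolding A_def using Q_mult[of "\<lambda>_. True"] by (simp only: simp_thms Collect_mem_eq)
    then show ?thesis by (simp add: card_image[OF inj])
  qed
  have card_B: "card B = Q * totient m"
    unfolding B_def by (rule card_coprime_residues_periods[OF m])
  have "C = {x \<in> {0..<int ?n}. int Q dvd x \<and> coprime x (int m)}"
    by (auto simp: C_def A_def B_def)
  then have "C = (*) (int Q) ` {t \<in> {0..<int m}. coprime t (int m)}"
    using cop by (simp only: Q_mult) (simp add: coprime_commute)
  then have card_C: "card C = totient m"
    using card_coprime_residues[OF m] by (simp add: card_image[OF inj])
  have fin: "finite A" "finite B"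
    by (rule finite_subset[of _ "{0..<int ?n}"]; auto simp: A_def B_def)+
  have card_S: "card S + 2 * totient m = m + Q * totient m"
  proof -
    have "card S + card C = card (A \<union> B)"
      using fin by (subst card_Un_disjoint[symmetric]) (auto simp: S_def C_def intro!: arg_cong[of _ _ card])
    moreover have "card (A \<union> B) + card C = card A + card B"
      using fin card_Un_Int[of A B] by (simp add: C_def)
    ultimately show ?thesis using card_A card_B card_C by simp
  qed
  \<comment> \<open>The residue \<open>Q\<close> generates the subgroup of order \<open>m\<close>, and \<open>m\<close> that of order \<open>Q\<close>.\<close>
  have Q_in_C: "int Q \<in> C"
    using m Q cop by (auto simp: C_def A_def B_def coprime_commute)
  have m_range: "int m \<in> {0..<int ?n}" using m Q by simp
  have "\<not> Q dvd m" using Q coprime_common_divisor[OF cop, of Q] by auto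
  then have m_notin: "int m \<notin> A \<union> B" using m by (auto simp: A_def B_def)
  have "\<not> connected (induce_subgraph ?G (verts ?G - S))" (is "\<not> connected ?H")
  proof (rule disconnected_if_no_arcs_between)
    show "int Q \<in> C" by (fact Q_in_C)
    show "int Q \<in> verts ?H" using Q_in_C by (auto simp: verts S_def C_def A_def)
    show "int m \<in> verts ?H" using m_range m_notin by (auto simp: verts S_def)
    show "int m \<notin> C" using m_notin by (auto simp: C_def)
  next
    fix x y assume "(x, y) \<in> arcs_ends ?H"
    then have xy: "(x, y) \<in> parcs (power_graph (integer_mod_group ?n))"
      and V: "x \<in> {0..<int ?n} - S" "y \<in> {0..<int ?n} - S"
      by (auto simp: arcs_ends_conv verts)
    have "v \<in> C" if "u \<in> C" "v \<in> {0..<int ?n} - S"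
      "(u, v) \<in> parcs (power_graph (integer_mod_group ?n)) \<or>
       (v, u) \<in> parcs (power_graph (integer_mod_group ?n))" for u v
      using neighbour_of_order_class[OF n _ _ that(3), of Q m] that(1,2)
      by (auto simp: S_def C_def A_def B_def)
    then show "x \<in> C \<longleftrightarrow> y \<in> C" using xy V by blast
  qed
  moreover have "finite S" using fin by (simp add: S_def)
  moreover have "S \<subset> verts ?G"
  proof
    show "S \<subseteq> verts ?G" by (auto simp: S_def A_def B_def verts)
    show "S \<noteq> verts ?G" using m_range m_notin unfolding with_proj_simps verts S_def by blast
  qed
  ultimately have "vertex_connectivity ?G \<le> card S"
    by (intro vertex_connectivity_le_card_separator)
  with card_S show ?thesis by linarith
qed

theorem theorem2p24:
  fixes n r :: nat and p \<alpha> :: "nat \<Rightarrow> nat"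
  assumes "0 < n"
    and "\<not> (\<exists>q q'. prime q \<and> prime q' \<and> n = q * q')"
    and "2 \<le> r"
    and "\<And>i. i \<in> {1..r} \<Longrightarrow> prime (p i)"
    and "strict_mono_on {1..r} p"
    and "\<And>i. i \<in> {1..r} \<Longrightarrow> 1 \<le> \<alpha> i"
    and "n = (\<Prod>i\<in>{1..r}. p i ^ \<alpha> i)"
  shows "int (vertex_connectivity (with_proj (power_graph (integer_mod_group n))))
    \<le> int (totient n) + int (n div p r ^ \<alpha> r)
      + int (totient (n div p r ^ \<alpha> r)) * (int (p r ^ (\<alpha> r - 1)) - 2)"
proof -
  define Q where "Q = p r ^ \<alpha> r"
  define m where "m = (\<Prod>i\<in>{1..<r}. p i ^ \<alpha> i)"
  have prime_r: "prime (p r)" and \<alpha>_r: "1 \<le> \<alpha> r" using assms(3,4,6) by auto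
  have Q: "1 < Q" unfolding Q_def using prime_gt_1_nat[OF prime_r] \<alpha>_r by (intro one_less_power) auto
  have "{1..r} = insert r {1..<r}" using assms(3) by auto
  then have n: "n = m * Q" by (simp add: assms(7) m_def Q_def mult.commute)
  have "coprime (p i ^ \<alpha> i) Q" if "i \<in> {1..<r}" for i
  proof -
    have "p i < p r" using that assms(5) by (auto simp: strict_mono_on_def)
    then show ?thesis
      unfolding Q_def using that assms(4)[of i] prime_r by (auto intro!: primes_coprime)
  qed
  then have cop: "coprime m Q" unfolding m_def by (intro prod_coprime_left)
  have m: "1 < m"
  proof -
    have "1 < p 1" "1 \<le> \<alpha> 1" using assms(3) prime_gt_1_nat[OF assms(4)] assms(6)[of 1] by auto
    then have "1 < p 1 ^ \<alpha> 1" by (intro one_less_power) auto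
    moreover have "p 1 ^ \<alpha> 1 dvd m" unfolding m_def using assms(3) by (intro dvd_prodI) auto
    moreover have "m \<noteq> 0" using n assms(1) by (intro notI) simp
    ultimately show ?thesis using dvd_imp_le[of "p 1 ^ \<alpha> 1" m] by linarith
  qed
  have "totient n + p r ^ (\<alpha> r - 1) * totient m = Q * totient m"
  proof -
    obtain b where b: "\<alpha> r = Suc b" using \<alpha>_r by (cases "\<alpha> r") auto
    obtain c where c: "p r = Suc c" using prime_gt_0_nat[OF prime_r] by (cases "p r") auto
    have "totient n = totient m * (p r ^ b * (p r - 1))"
      using totient_mult_coprime[OF cop] totient_prime_power_Suc[OF prime_r, of b]
      by (simp add: n Q_def b)
    then show ?thesis by (simp add: Q_def b c algebra_simps)
  qed
  moreover have "vertex_connectivity (with_proj (power_graph (integer_mod_group n))) + 2 * totient m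
      \<le> m + Q * totient m"
    unfolding n by (rule vertex_connectivity_power_graph_coprime_factors[OF m Q cop])
  ultimately have "vertex_connectivity (with_proj (power_graph (integer_mod_group n)))
      + 2 * totient m \<le> m + totient n + p r ^ (\<alpha> r - 1) * totient m" by linarith
  then have "int (vertex_connectivity (with_proj (power_graph (integer_mod_group n)))
      + 2 * totient m) \<le> int (m + totient n + p r ^ (\<alpha> r - 1) * totient m)"
    by (rule of_nat_mono)
  then have "int (vertex_connectivity (with_proj (power_graph (integer_mod_group n))))
      \<le> int (totient n) + int m + int (totient m) * (int (p r ^ (\<alpha> r - 1)) - 2)"
    by (simp only: of_nat_add of_nat_mult of_nat_numeral right_diff_distrib mult.commute)
  moreover have "n div p r ^ \<alpha> r = m" using Q by (simp add: n Q_def[symmetric])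
  ultimately show ?thesis by simp
qed

end
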